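(* Let $\mathbf{A}$ be a category, $P$ a partial order and $M$ a monoid, such that, with data $0,F,\alpha,\beta,\beta'$, the conditions (A1')--(A7') listed in the context are satisfied. Then there is an equivalence of categories $\mathbf{A}\to P\rtimes M$ given by $x\mapsto\beta(x)$ on objects and $f\mapsto\alpha(F(f))$ on morphisms, where $P\rtimes M$ is formed with respect to the induced action of $M$ on $P$ described in the context.
   Context: **Conditions (A1')--(A7'):** (A1') there is a weak initial object $0$ in $\mathbf{A}$ (every object $x$ admits a not necessarily unique morphism $0\to x$), unique up to isomorphism; (A2') there is a faithful functor $F:\mathbf{A}\to\mathbf{A}(0,0)$ that is a retraction (left inverse) of the inclusion $\mathbf{A}(0,0)\hookrightarrow\mathbf{A}$, where the endomorphism monoid $\mathbf{A}(0,0)$ is regarded as a one-object category; (A3') there is an isomorphism of monoids $\alpha:\mathbf{A}(0,0)\to M^{\mathrm{op}}$; (A4') there is an equivalence of preorders $\beta:(\mathbf{A},\le)\to P$, $\beta':P\to(\mathbf{A},\le)$, where the objects of $\mathbf{A}$ are preordered by $x\le y$ iff there is $f\in\mathbf{A}(x,y)$ with $F(f)=1$; (A5') for each object $x$ there is an isomorphism $f:x\to\beta'(\beta(x))$ with $\alpha(F(f))=1$; (A6') for each object $y$ and $m:0\to0$ there is $f:x\to y$ with $F(f)=m$ that is universal: for any $f':x'\to y$ with $F(f')=m$ there is $g:x'\to x$ with $f'=fg$ and $F(g)=1$; (A7') if $\alpha(F(f))=m_2m_1$ in $M$ for a morphism $f$, then $f=f_1f_2$ for morphisms with $\alpha(F(f_i))=m_i$.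 **Induced action.** $M$ acts on $P$ by order-preserving maps via $mp=\beta(x)$, where $f:x\to\beta'(p)$ is any maximal morphism with $\alpha(F(f))=m$; here maximal means that any $f':x'\to\beta'(p)$ with $\alpha(F(f'))=m$ factors as $f'=fg$ with $F(g)=1$. **Grothendieck construction.** For a monoid $M$ acting on a poset $P$, $P\rtimes M$ is the category whose objects are those of $P$, whose morphisms $p\to q$ are the $m\in M$ with $p\le mq$, and whose units and composition are inherited from $M^{\mathrm{op}}$ (the composite of $m:p\to q$ followed by $n:q\to r$ is $mn$). *)

theory Defs
  imports "HOL-Algebra.Group"
begin

section \<open>Categories\<close>

record ('o, 'a) cat =
  Obj :: "'o set"
  Arr :: "'a set"
  Dom :: "'a \<Rightarrow> 'o"
  Cod :: "'a \<Rightarrow> 'o"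
  Ident :: "'o \<Rightarrow> 'a"
  Comp :: "'a \<Rightarrow> 'a \<Rightarrow> 'a"  (infixl \<open>\<cdot>\<index>\<close> 70)

text \<open>Composition is in applicative order: \<open>g \<cdot> f\<close> is \<open>f\<close> followed by \<open>g\<close>, and it is
  meaningful only if \<open>Dom g = Cod f\<close>.\<close>

definition Hom :: "('o, 'a, 'z) cat_scheme \<Rightarrow> 'o \<Rightarrow> 'o \<Rightarrow> 'a set"
  where "Hom C x y = {f \<in> Arr C. Dom C f = x \<and> Cod C f = y}"

locale category =
  fixes C :: "('o, 'a, 'z) cat_scheme" (structure)
  assumes Dom_closed: "f \<in> Arr C \<Longrightarrow> Dom C f \<in> Obj C"
    and Cod_closed: "f \<in> Arr C \<Longrightarrow> Cod C f \<in> Obj C"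
    and Ident_closed: "x \<in> Obj C \<Longrightarrow> Ident C x \<in> Hom C x x"
    and Comp_closed: "\<lbrakk>f \<in> Hom C x y; g \<in> Hom C y z\<rbrakk> \<Longrightarrow> g \<cdot> f \<in> Hom C x z"
    and Comp_Ident_right: "f \<in> Hom C x y \<Longrightarrow> f \<cdot> Ident C x = f"
    and Comp_Ident_left: "f \<in> Hom C x y \<Longrightarrow> Ident C y \<cdot> f = f"
    and Comp_assoc: "\<lbrakk>f \<in> Hom C w x; g \<in> Hom C x y; h \<in> Hom C y z\<rbrakk>
      \<Longrightarrow> (h \<cdot> g) \<cdot> f = h \<cdot> (g \<cdot> f)"

definition is_isomorphism :: "('o, 'a, 'z) cat_scheme \<Rightarrow> 'a \<Rightarrow> bool"
  where "is_isomorphism C f \<longleftrightarrow> f \<in> Arr C \<and>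
    (\<exists>g \<in> Hom C (Cod C f) (Dom C f).
      g \<cdot>\<^bsub>C\<^esub> f = Ident C (Dom C f) \<and> f \<cdot>\<^bsub>C\<^esub> g = Ident C (Cod C f))"

definition isomorphic :: "('o, 'a, 'z) cat_scheme \<Rightarrow> 'o \<Rightarrow> 'o \<Rightarrow> bool"
  where "isomorphic C x y \<longleftrightarrow> (\<exists>f \<in> Hom C x y. is_isomorphism C f)"

definition weak_initial :: "('o, 'a, 'z) cat_scheme \<Rightarrow> 'o \<Rightarrow> bool"
  where "weak_initial C z \<longleftrightarrow> z \<in> Obj C \<and> (\<forall>x \<in> Obj C. Hom C z x \<noteq> {})"

text \<open>The endomorphism monoid of an object \<open>z\<close>, as a monoid and as a one-object category
  (whose object is \<open>z\<close> itself, so that its inclusion into \<open>C\<close> is the identity on objects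
  and on arrows).\<close>

definition endo_monoid :: "('o, 'a, 'z) cat_scheme \<Rightarrow> 'o \<Rightarrow> 'a monoid"
  where "endo_monoid C z = \<lparr>carrier = Hom C z z, mult = Comp C, one = Ident C z\<rparr>"

definition endo_cat :: "('o, 'a) cat \<Rightarrow> 'o \<Rightarrow> ('o, 'a) cat"
  where "endo_cat C z = C\<lparr>Obj := {z}, Arr := Hom C z z\<rparr>"

definition op_monoid :: "('m, 'z) monoid_scheme \<Rightarrow> 'm monoid"
  where "op_monoid M = \<lparr>carrier = carrier M, mult = (\<lambda>m n. n \<otimes>\<^bsub>M\<^esub> m), one = \<one>\<^bsub>M\<^esub>\<rparr>"


section \<open>Functors and equivalences\<close>

record ('o, 'a, 'p, 'b) ftor =
  omap :: "'o \<Rightarrow> 'p"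
  amap :: "'a \<Rightarrow> 'b"

definition is_functor ::
    "('o, 'a) cat \<Rightarrow> ('p, 'b) cat \<Rightarrow> ('o, 'a, 'p, 'b) ftor \<Rightarrow> bool"
  where "is_functor C D F \<longleftrightarrow> category C \<and> category D \<and>
    (\<forall>x \<in> Obj C. omap F x \<in> Obj D) \<and>
    (\<forall>f \<in> Arr C. amap F f \<in> Hom D (omap F (Dom C f)) (omap F (Cod C f))) \<and>
    (\<forall>x \<in> Obj C. amap F (Ident C x) = Ident D (omap F x)) \<and>
    (\<forall>f \<in> Arr C. \<forall>g \<in> Arr C. Dom C g = Cod C f \<longrightarrow>
      amap F (g \<cdot>\<^bsub>C\<^esub> f) = amap F g \<cdot>\<^bsub>D\<^esub> amap F f)"

definition faithful :: "('o, 'a) cat \<Rightarrow> ('o, 'a, 'p, 'b) ftor \<Rightarrow> bool"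
  where "faithful C F \<longleftrightarrow> (\<forall>x \<in> Obj C. \<forall>y \<in> Obj C. inj_on (amap F) (Hom C x y))"

text \<open>For a subcategory \<open>B\<close> of \<open>C\<close>: the functor \<open>F\<close> from \<open>C\<close> to \<open>B\<close> is a left inverse of
  the inclusion of \<open>B\<close> into \<open>C\<close>.\<close>

definition left_inverse_of_inclusion ::
    "('o, 'a) cat \<Rightarrow> ('o, 'a, 'o, 'a) ftor \<Rightarrow> bool"
  where "left_inverse_of_inclusion B F \<longleftrightarrow>
    (\<forall>x \<in> Obj B. omap F x = x) \<and> (\<forall>f \<in> Arr B. amap F f = f)"

definition id_ftor :: "('o, 'a, 'o, 'a) ftor"
  where "id_ftor = \<lparr>omap = (\<lambda>x. x), amap = (\<lambda>f. f)\<rparr>"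

definition comp_ftor ::
    "('p, 'b, 'q, 'c) ftor \<Rightarrow> ('o, 'a, 'p, 'b) ftor \<Rightarrow> ('o, 'a, 'q, 'c) ftor"
  where "comp_ftor G F = \<lparr>omap = omap G \<circ> omap F, amap = amap G \<circ> amap F\<rparr>"

definition is_nat_iso ::
    "('o, 'a) cat \<Rightarrow> ('p, 'b) cat \<Rightarrow> ('o, 'a, 'p, 'b) ftor \<Rightarrow> ('o, 'a, 'p, 'b) ftor \<Rightarrow>
      ('o \<Rightarrow> 'b) \<Rightarrow> bool"
  where "is_nat_iso C D F G \<tau> \<longleftrightarrow> is_functor C D F \<and> is_functor C D G \<and>
    (\<forall>x \<in> Obj C. \<tau> x \<in> Hom D (omap F x) (omap G x) \<and> is_isomorphism D (\<tau> x)) \<and>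
    (\<forall>f \<in> Arr C. \<tau> (Cod C f) \<cdot>\<^bsub>D\<^esub> amap F f = amap G f \<cdot>\<^bsub>D\<^esub> \<tau> (Dom C f))"

definition is_equivalence ::
    "('o, 'a) cat \<Rightarrow> ('p, 'b) cat \<Rightarrow> ('o, 'a, 'p, 'b) ftor \<Rightarrow> bool"
  where "is_equivalence C D F \<longleftrightarrow> is_functor C D F \<and>
    (\<exists>G \<eta> \<epsilon>. is_functor D C G \<and>
      is_nat_iso C C id_ftor (comp_ftor G F) \<eta> \<and>
      is_nat_iso D D (comp_ftor F G) id_ftor \<epsilon>)"


section \<open>Preorders\<close>

text \<open>A preorder is a \<^locale>\<open>weak_partial_order\<close> whose equality \<open>.=\<close> is the equivalence
  relation induced by the preorder. Here \<open>x \<le> y\<close> iff there is an arrow from \<open>x\<close> to \<open>y\<close>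
  that \<open>F\<close> maps to the identity of \<open>z\<close>.\<close>

definition arrow_le :: "('o, 'a) cat \<Rightarrow> 'o \<Rightarrow> ('o, 'a, 'o, 'a) ftor \<Rightarrow> 'o \<Rightarrow> 'o \<Rightarrow> bool"
  where "arrow_le C z F x y \<longleftrightarrow> (\<exists>f \<in> Hom C x y. amap F f = Ident C z)"

definition arrow_preorder :: "('o, 'a) cat \<Rightarrow> 'o \<Rightarrow> ('o, 'a, 'o, 'a) ftor \<Rightarrow> 'o gorder"
  where "arrow_preorder C z F =
    \<lparr>carrier = Obj C,
     eq = (\<lambda>x y. arrow_le C z F x y \<and> arrow_le C z F y x),
     le = arrow_le C z F\<rparr>"

lemma weak_partial_order_arrow_preorder:
  assumes F: "is_functor C (endo_cat C z) F"
  shows "weak_partial_order (arrow_preorder C z F)"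
proof -
  interpret category C using F by (simp add: is_functor_def)
  have omap_F: "omap F x = z" if "x \<in> Obj C" for x
    using F that by (simp add: is_functor_def endo_cat_def)
  have refl: "arrow_le C z F x x" if x: "x \<in> Obj C" for x
    unfolding arrow_le_def
    using F x Ident_closed[OF x] omap_F[OF x]
    by (intro bexI[of _ "Ident C x"]) (simp_all add: is_functor_def endo_cat_def)
  have trans: "arrow_le C z F x w"
    if x: "x \<in> Obj C" and xy: "arrow_le C z F x y" and yw: "arrow_le C z F y w" for x y w
  proof -
    from xy yw obtain f g where fg: "f \<in> Hom C x y" "amap F f = Ident C z"
        "g \<in> Hom C y w" "amap F g = Ident C z"
      unfolding arrow_le_def by blast
    have "category (endo_cat C z)" using F by (simp add: is_functor_def)
    then have "Ident C z \<in> Hom C z z"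
      using category.Ident_closed[of "endo_cat C z" z]
      by (auto simp add: endo_cat_def Hom_def)
    then have "Ident C z \<cdot>\<^bsub>C\<^esub> Ident C z = Ident C z" by (rule Comp_Ident_right)
    moreover have "amap F (g \<cdot>\<^bsub>C\<^esub> f) = amap F g \<cdot>\<^bsub>C\<^esub> amap F f"
      using F fg unfolding is_functor_def endo_cat_def Hom_def by simp
    ultimately show ?thesis
      unfolding arrow_le_def using fg Comp_closed by (intro bexI[of _ "g \<cdot>\<^bsub>C\<^esub> f"]) auto
  qed
  show ?thesis
    by unfold_locales (auto simp add: arrow_preorder_def intro: refl trans)
qed

definition preorder_equivalence ::
    "('a, 'y) gorder_scheme \<Rightarrow> ('b, 'z) gorder_scheme \<Rightarrow> ('a \<Rightarrow> 'b) \<Rightarrow> ('b \<Rightarrow> 'a) \<Rightarrow> bool"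
  where "preorder_equivalence K L f g \<longleftrightarrow>
    f \<in> carrier K \<rightarrow> carrier L \<and> isotone K L f \<and>
    g \<in> carrier L \<rightarrow> carrier K \<and> isotone L K g \<and>
    (\<forall>x \<in> carrier K. g (f x) .=\<^bsub>K\<^esub> x) \<and>
    (\<forall>y \<in> carrier L. f (g y) .=\<^bsub>L\<^esub> y)"


section \<open>Monoid actions on posets and the Grothendieck construction\<close>

locale monoid_poset_action = monoid M + partial_order P
  for M :: "('m, 'y) monoid_scheme" and P :: "('p, 'z) gorder_scheme"
    and act :: "'m \<Rightarrow> 'p \<Rightarrow> 'p" +
  assumes act_closed: "\<lbrakk>m \<in> carrier M; p \<in> carrier P\<rbrakk> \<Longrightarrow> act m p \<in> carrier P"
    and act_one: "p \<in> carrier P \<Longrightarrow> act \<one>\<^bsub>M\<^esub> p = p"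
    and act_mult: "\<lbrakk>m \<in> carrier M; n \<in> carrier M; p \<in> carrier P\<rbrakk>
      \<Longrightarrow> act (m \<otimes>\<^bsub>M\<^esub> n) p = act m (act n p)"
    and act_mono: "\<lbrakk>m \<in> carrier M; p \<in> carrier P; q \<in> carrier P; p \<sqsubseteq>\<^bsub>P\<^esub> q\<rbrakk>
      \<Longrightarrow> act m p \<sqsubseteq>\<^bsub>P\<^esub> act m q"

text \<open>An arrow \<open>m : p \<rightarrow> q\<close> is encoded as the triple \<open>(p, m, q)\<close>, since the same \<open>m\<close> belongs to
  many hom-sets. The composite of \<open>m : p \<rightarrow> q\<close> followed by \<open>n : q \<rightarrow> r\<close> is \<open>m \<otimes> n\<close>.\<close>

definition grothendieck ::
    "('p, 'z) gorder_scheme \<Rightarrow> ('m, 'y) monoid_scheme \<Rightarrow> ('m \<Rightarrow> 'p \<Rightarrow> 'p) \<Rightarrow>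
      ('p, 'p \<times> 'm \<times> 'p) cat"
  where "grothendieck P M act =
    \<lparr>Obj = carrier P,
     Arr = {(p, m, q). p \<in> carrier P \<and> m \<in> carrier M \<and> q \<in> carrier P \<and> p \<sqsubseteq>\<^bsub>P\<^esub> act m q},
     Dom = (\<lambda>(p, m, q). p),
     Cod = (\<lambda>(p, m, q). q),
     Ident = (\<lambda>p. (p, \<one>\<^bsub>M\<^esub>, p)),
     Comp = (\<lambda>(_, n, r) (p, m, _). (p, m \<otimes>\<^bsub>M\<^esub> n, r))\<rparr>"

definition maximal_arrow ::
    "('o, 'a) cat \<Rightarrow> 'o \<Rightarrow> ('o, 'a, 'o, 'a) ftor \<Rightarrow> ('a \<Rightarrow> 'm) \<Rightarrow> 'o \<Rightarrow> 'm \<Rightarrow> 'a \<Rightarrow> bool"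
  where "maximal_arrow A z F \<alpha> y m f \<longleftrightarrow>
    f \<in> Arr A \<and> Cod A f = y \<and> \<alpha> (amap F f) = m \<and>
    (\<forall>f' \<in> Arr A. Cod A f' = y \<and> \<alpha> (amap F f') = m \<longrightarrow>
      (\<exists>g \<in> Hom A (Dom A f') (Dom A f). f' = f \<cdot>\<^bsub>A\<^esub> g \<and> amap F g = Ident A z))"

text \<open>\<open>m p = \<beta> x\<close> for any maximal \<open>f : x \<rightarrow> \<beta>' p\<close> over \<open>m\<close>. The description is proper only if
  such an \<open>f\<close> exists and \<open>\<beta> x\<close> does not depend on its choice.\<close>

definition induced_action ::
    "('o, 'a) cat \<Rightarrow> 'o \<Rightarrow> ('o, 'a, 'o, 'a) ftor \<Rightarrow> ('a \<Rightarrow> 'm) \<Rightarrow> ('o \<Rightarrow> 'p) \<Rightarrow> ('p \<Rightarrow> 'o) \<Rightarrow>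
      'm \<Rightarrow> 'p \<Rightarrow> 'p"
  where "induced_action A z F \<alpha> \<beta> \<beta>' m p =
    (THE q. \<exists>f. maximal_arrow A z F \<alpha> (\<beta>' p) m f \<and> q = \<beta> (Dom A f))"

end

theory Submission
  imports Defs
begin

text \<open>
  Write \<open>d f = \<alpha> (F f)\<close> for the degree of an arrow of \<open>A\<close>. Since \<open>F\<close> is faithful and \<open>\<alpha>\<close> is
  injective, an arrow is determined by its endpoints and its degree, so \<open>A\<close> is known once the
  relation \<^emph>\<open>there is an arrow \<open>x \<rightarrow> y\<close> of degree \<open>m\<close>\<close> is known. Everything rests on one
  equivalence, \<open>arrow_of_degree_iff\<close>:

    there is an arrow \<open>x \<rightarrow> y\<close> of degree \<open>m\<close> if and only if \<open>\<beta> x \<sqsubseteq> m (\<beta> y)\<close>.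

  Since arrows of degree \<open>\<one>\<close> connect \<open>y\<close> and \<open>\<beta>' (\<beta> y)\<close> in both directions, one may replace
  \<open>y\<close> by \<open>y' = \<beta>' (\<beta> y)\<close>. Fix a maximal arrow \<open>x\<^sub>0 \<rightarrow> y'\<close> of degree \<open>m\<close>. The arrows \<open>x \<rightarrow> y'\<close> of
  degree \<open>m\<close> are the composites of this one with arrows \<open>x \<rightarrow> x\<^sub>0\<close> of degree \<open>\<one>\<close>, and such an arrow
  exists precisely when \<open>\<beta> x \<sqsubseteq> \<beta> x\<^sub>0\<close>; but \<open>\<beta> x\<^sub>0\<close> is \<open>m (\<beta> y)\<close> by definition of the action.

  The equivalence has two uses. First, as \<open>P\<close> is a partial order, \<open>m q\<close> is determined by the
  elements below it, and these are described by arrows; so the axioms of an action become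
  statements about arrows: identities give the unit law, composition and the factorization of
  arrows along products of degrees give the law for products, and composition with arrows of
  degree \<open>\<one>\<close> gives monotonicity. Secondly, the right-hand side is the definition of an arrow
  \<open>\<beta> x \<rightarrow> \<beta> y\<close> of the Grothendieck construction, so that the functor in question is full and
  faithful. It is onto on objects because \<open>\<beta> (\<beta>' p) = p\<close>, and a fully faithful functor with a
  section on objects is an equivalence (\<open>fully_faithful_with_section_is_equivalence\<close>).
\<close>


section \<open>Fully faithful functors with a section on objects\<close>

lemma Hom_Obj:
  assumes "category C" "f \<in> Hom C x y"
  shows "x \<in> Obj C" "y \<in> Obj C"
  using assms category.Dom_closed category.Cod_closed by (fastforce simp: Hom_def)+

lemma is_isomorphismI:
  assumes "f \<in> Hom C x y" "g \<in> Hom C y x" "g \<cdot>\<^bsub>C\<^esub> f = Ident C x" "f \<cdot>\<^bsub>C\<^esub> g = Ident C y"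
  shows "is_isomorphism C f"
  using assms by (auto simp: is_isomorphism_def Hom_def)

lemma is_functorD:
  assumes "is_functor C D F"
  shows "category C" "category D"
    and "x \<in> Obj C \<Longrightarrow> omap F x \<in> Obj D"
    and "f \<in> Hom C x y \<Longrightarrow> amap F f \<in> Hom D (omap F x) (omap F y)"
    and "x \<in> Obj C \<Longrightarrow> amap F (Ident C x) = Ident D (omap F x)"
    and "\<lbrakk>f \<in> Hom C x y; g \<in> Hom C y z\<rbrakk> \<Longrightarrow> amap F (g \<cdot>\<^bsub>C\<^esub> f) = amap F g \<cdot>\<^bsub>D\<^esub> amap F f"
  using assms by (auto simp: is_functor_def Hom_def)

lemma is_functorI:
  assumes "category C" "category D"
    and "\<And>x. x \<in> Obj C \<Longrightarrow> omap F x \<in> Obj D"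
    and "\<And>x y f. f \<in> Hom C x y \<Longrightarrow> amap F f \<in> Hom D (omap F x) (omap F y)"
    and "\<And>x. x \<in> Obj C \<Longrightarrow> amap F (Ident C x) = Ident D (omap F x)"
    and "\<And>x y z f g. \<lbrakk>f \<in> Hom C x y; g \<in> Hom C y z\<rbrakk>
      \<Longrightarrow> amap F (g \<cdot>\<^bsub>C\<^esub> f) = amap F g \<cdot>\<^bsub>D\<^esub> amap F f"
  shows "is_functor C D F"
  unfolding is_functor_def using assms by (simp add: Hom_def)

lemma is_functor_id: "category C \<Longrightarrow> is_functor C C id_ftor"
  by (rule is_functorI) (simp_all add: id_ftor_def)

lemma is_functor_comp:
  assumes F: "is_functor C D F" and G: "is_functor D E G"
  shows "is_functor C E (comp_ftor G F)"
proof (rule is_functorI)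
  show "category C" "category E" using is_functorD F G by auto
qed (auto simp: comp_ftor_def is_functorD[OF F] is_functorD(3,5)[OF G]
    intro: is_functorD(4)[OF F] is_functorD(4)[OF G] is_functorD(6)[OF G])

text \<open>The inverse functor sends an arrow \<open>p \<rightarrow> q\<close> to its unique preimage \<open>s p \<rightarrow> s q\<close>, and the
  unit at \<open>x\<close> is the unique preimage \<open>x \<rightarrow> s (F x)\<close> of the identity of \<open>F x = F (s (F x))\<close>. All
  equations hold since \<open>F\<close> maps both sides to the same arrow. As \<open>F (s p)\<close> is equal to \<open>p\<close> and
  not only isomorphic to it, the identities form the counit.\<close>

lemma fully_faithful_with_section_is_equivalence:
  fixes C :: "('o, 'a) cat" and D :: "('p, 'b) cat"
  assumes F: "is_functor C D F"
    and section_closed: "\<And>p. p \<in> Obj D \<Longrightarrow> s p \<in> Obj C"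
    and F_section: "\<And>p. p \<in> Obj D \<Longrightarrow> omap F (s p) = p"
    and fully_faithful: "\<And>x y. \<lbrakk>x \<in> Obj C; y \<in> Obj C\<rbrakk>
      \<Longrightarrow> bij_betw (amap F) (Hom C x y) (Hom D (omap F x) (omap F y))"
  shows "is_equivalence C D F"
proof -
  note F_cat = is_functorD(1,2)[OF F] and F_obj = is_functorD(3)[OF F]
    and F_hom = is_functorD(4)[OF F] and F_id = is_functorD(5)[OF F]
    and F_comp = is_functorD(6)[OF F]
  interpret C: category C by (rule F_cat)
  interpret D: category D by (rule F_cat)
  define lift where "lift x y h = inv_into (Hom C x y) (amap F) h" for x y h
  have lift: "lift x y h \<in> Hom C x y" "amap F (lift x y h) = h"
    if "x \<in> Obj C" "y \<in> Obj C" "h \<in> Hom D (omap F x) (omap F y)" for x y h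
    using that fully_faithful[of x y] unfolding lift_def bij_betw_def
    by (metis inv_into_into, metis f_inv_into_f)
  have eqI: "f = g" if "f \<in> Hom C x y" "g \<in> Hom C x y" "amap F f = amap F g" for f g x y
    using that fully_faithful[of x y] Hom_Obj[OF F_cat(1), of f x y]
    by (auto simp: bij_betw_def dest: inj_onD)
  define G where "G = \<lparr>omap = s, amap = (\<lambda>h. lift (s (Dom D h)) (s (Cod D h)) h)\<rparr>"
  have G_lift: "amap G h = lift (s p) (s q) h" if "h \<in> Hom D p q" for h p q
    using that by (auto simp: G_def Hom_def)
  have G_omap: "omap G = s" by (simp add: G_def)
  have G_hom: "amap G h \<in> Hom C (s p) (s q)" and F_G: "amap F (amap G h) = h"
    if h: "h \<in> Hom D p q" for h p q
    using lift[of "s p" "s q" h] h Hom_Obj[OF F_cat(2) h] section_closed F_section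
    by (simp_all add: G_lift)
  have G: "is_functor D C G"
  proof (rule is_functorI[OF F_cat(2,1)])
    show "omap G p \<in> Obj C" if "p \<in> Obj D" for p
      using that by (simp add: G_omap section_closed)
    show "amap G h \<in> Hom C (omap G p) (omap G q)" if "h \<in> Hom D p q" for p q h
      using that by (simp add: G_omap G_hom)
    show "amap G (Ident D p) = Ident C (omap G p)" if p: "p \<in> Obj D" for p
      by (rule eqI[of _ "s p" "s p"])
        (use p in \<open>auto simp: G_omap F_G[OF D.Ident_closed] F_id F_section section_closed
          intro: G_hom D.Ident_closed C.Ident_closed\<close>)
    show "amap G (k \<cdot>\<^bsub>D\<^esub> h) = amap G k \<cdot>\<^bsub>C\<^esub> amap G h"
      if hk: "h \<in> Hom D p q" "k \<in> Hom D q r" for p q r h k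
    proof (rule eqI)
      show "amap G (k \<cdot>\<^bsub>D\<^esub> h) \<in> Hom C (s p) (s r)"
        by (rule G_hom) (rule D.Comp_closed[OF hk])
      show "amap G k \<cdot>\<^bsub>C\<^esub> amap G h \<in> Hom C (s p) (s r)"
        by (rule C.Comp_closed) (use hk G_hom in auto)
      show "amap F (amap G (k \<cdot>\<^bsub>D\<^esub> h)) = amap F (amap G k \<cdot>\<^bsub>C\<^esub> amap G h)"
        using F_G[OF D.Comp_closed[OF hk]] F_comp[OF G_hom[OF hk(1)] G_hom[OF hk(2)]]
          F_G[OF hk(1)] F_G[OF hk(2)] by simp
    qed
  qed
  have s_F: "s (omap F x) \<in> Obj C" "omap F (s (omap F x)) = omap F x" if "x \<in> Obj C" for x
    using that F_obj section_closed F_section by auto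
  define \<eta> where "\<eta> x = lift x (s (omap F x)) (Ident D (omap F x))" for x
  have \<eta>: "\<eta> x \<in> Hom C x (s (omap F x))" "amap F (\<eta> x) = Ident D (omap F x)"
    if x: "x \<in> Obj C" for x
    using lift[OF x s_F(1)[OF x]] s_F[OF x] D.Ident_closed[OF F_obj[OF x]]
    by (simp_all add: \<eta>_def)
  have \<eta>_iso: "is_isomorphism C (\<eta> x)" if x: "x \<in> Obj C" for x
  proof -
    define \<theta> where "\<theta> = lift (s (omap F x)) x (Ident D (omap F x))"
    have \<theta>: "\<theta> \<in> Hom C (s (omap F x)) x" "amap F \<theta> = Ident D (omap F x)"
      using lift[OF s_F(1)[OF x] x] s_F[OF x] D.Ident_closed[OF F_obj[OF x]]
      by (simp_all add: \<theta>_def)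
    note id = D.Comp_Ident_left[OF D.Ident_closed[OF F_obj[OF x]]]
    show ?thesis
    proof (rule is_isomorphismI[OF \<eta>(1)[OF x] \<theta>(1)])
      show "\<theta> \<cdot>\<^bsub>C\<^esub> \<eta> x = Ident C x"
        by (rule eqI[OF C.Comp_closed[OF \<eta>(1)[OF x] \<theta>(1)] C.Ident_closed[OF x]])
          (simp add: F_comp[OF \<eta>(1)[OF x] \<theta>(1)] \<eta>(2)[OF x] \<theta>(2) F_id[OF x] id)
      show "\<eta> x \<cdot>\<^bsub>C\<^esub> \<theta> = Ident C (s (omap F x))"
        by (rule eqI[OF C.Comp_closed[OF \<theta>(1) \<eta>(1)[OF x]] C.Ident_closed[OF s_F(1)[OF x]]])
          (simp add: F_comp[OF \<theta>(1) \<eta>(1)[OF x]] \<eta>(2)[OF x] \<theta>(2) F_id[OF s_F(1)[OF x]]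
            s_F(2)[OF x] id)
    qed
  qed
  have "is_nat_iso C C id_ftor (comp_ftor G F) \<eta>"
    unfolding is_nat_iso_def
  proof (intro conjI ballI)
    show "is_functor C C id_ftor" by (rule is_functor_id[OF F_cat(1)])
    show "is_functor C C (comp_ftor G F)" by (rule is_functor_comp[OF F G])
    show "\<eta> x \<in> Hom C (omap id_ftor x) (omap (comp_ftor G F) x)" if "x \<in> Obj C" for x
      using \<eta>[OF that] by (simp add: id_ftor_def comp_ftor_def G_omap)
    show "is_isomorphism C (\<eta> x)" if "x \<in> Obj C" for x by (rule \<eta>_iso[OF that])
    show "\<eta> (Cod C f) \<cdot>\<^bsub>C\<^esub> amap id_ftor f = amap (comp_ftor G F) f \<cdot>\<^bsub>C\<^esub> \<eta> (Dom C f)"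
      if "f \<in> Arr C" for f
    proof -
      define x y where "x = Dom C f" and "y = Cod C f"
      have f: "f \<in> Hom C x y" using that by (simp add: x_def y_def Hom_def)
      have x: "x \<in> Obj C" and y: "y \<in> Obj C" using Hom_Obj[OF F_cat(1) f] by auto
      note GFf = G_hom[OF F_hom[OF f]]
      have "\<eta> y \<cdot>\<^bsub>C\<^esub> f = amap G (amap F f) \<cdot>\<^bsub>C\<^esub> \<eta> x"
        by (rule eqI[OF C.Comp_closed[OF f \<eta>(1)[OF y]] C.Comp_closed[OF \<eta>(1)[OF x] GFf]])
          (simp add: F_comp[OF f \<eta>(1)[OF y]] F_comp[OF \<eta>(1)[OF x] GFf] \<eta>(2) x y
            F_G[OF F_hom[OF f]] D.Comp_Ident_left[OF F_hom[OF f]]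
            D.Comp_Ident_right[OF F_hom[OF f]])
      then show ?thesis by (simp add: x_def y_def id_ftor_def comp_ftor_def)
    qed
  qed
  moreover have "is_nat_iso D D (comp_ftor F G) id_ftor (Ident D)"
    unfolding is_nat_iso_def
  proof (intro conjI ballI)
    show "is_functor D D id_ftor" by (rule is_functor_id[OF F_cat(2)])
    show "is_functor D D (comp_ftor F G)" by (rule is_functor_comp[OF G F])
    show "Ident D p \<in> Hom D (omap (comp_ftor F G) p) (omap id_ftor p)" if "p \<in> Obj D" for p
      using D.Ident_closed[OF that] F_section[OF that]
      by (simp add: id_ftor_def comp_ftor_def G_omap)
    show "is_isomorphism D (Ident D p)" if "p \<in> Obj D" for p
      using D.Ident_closed[OF that] D.Comp_Ident_left is_isomorphismI by metis
    show "Ident D (Cod D h) \<cdot>\<^bsub>D\<^esub> amap (comp_ftor F G) h = amap id_ftor h \<cdot>\<^bsub>D\<^esub> Ident D (Dom D h)"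
      if "h \<in> Arr D" for h
    proof -
      have h: "h \<in> Hom D (Dom D h) (Cod D h)" using that by (simp add: Hom_def)
      show ?thesis
        using F_G[OF h] D.Comp_Ident_left[OF h] D.Comp_Ident_right[OF h]
        by (simp add: id_ftor_def comp_ftor_def)
    qed
  qed
  ultimately show ?thesis
    unfolding is_equivalence_def using F G by blast
qed


section \<open>The Grothendieck construction is a category\<close>

lemma Hom_grothendieck:
  "(p', m, q') \<in> Hom (grothendieck P M act) p q \<longleftrightarrow>
    p' = p \<and> q' = q \<and> p \<in> carrier P \<and> m \<in> carrier M \<and> q \<in> carrier P \<and> p \<sqsubseteq>\<^bsub>P\<^esub> act m q"
  by (auto simp: grothendieck_def Hom_def)

lemma Hom_grothendieckE:
  assumes "h \<in> Hom (grothendieck P M act) p q"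
  obtains m where "h = (p, m, q)" "p \<in> carrier P" "m \<in> carrier M" "q \<in> carrier P"
    "p \<sqsubseteq>\<^bsub>P\<^esub> act m q"
  using assms by (cases h) (auto simp: Hom_grothendieck)

lemma grothendieck_simps [simp]:
  "Obj (grothendieck P M act) = carrier P"
  "Ident (grothendieck P M act) p = (p, \<one>\<^bsub>M\<^esub>, p)"
  "(q', n, r) \<cdot>\<^bsub>grothendieck P M act\<^esub> (p, m, q) = (p, m \<otimes>\<^bsub>M\<^esub> n, r)"
  by (simp_all add: grothendieck_def)

text \<open>Arrows compose since \<open>p \<sqsubseteq> m q\<close> and \<open>q \<sqsubseteq> n r\<close> imply \<open>p \<sqsubseteq> m q \<sqsubseteq> m (n r) = (m n) r\<close>.\<close>

lemma (in monoid_poset_action) category_grothendieck: "category (grothendieck P M act)"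
proof
  let ?G = "grothendieck P M act"
  show "Dom ?G h \<in> Obj ?G" "Cod ?G h \<in> Obj ?G" if "h \<in> Arr ?G" for h
    using that by (auto simp: grothendieck_def)
  show "Ident ?G p \<in> Hom ?G p p" if "p \<in> Obj ?G" for p
    using that by (simp add: Hom_grothendieck act_one)
  show "k \<cdot>\<^bsub>?G\<^esub> h \<in> Hom ?G p r" if hk: "h \<in> Hom ?G p q" "k \<in> Hom ?G q r" for p q r h k
  proof -
    obtain m where h: "h = (p, m, q)" "p \<in> carrier P" "m \<in> carrier M" "q \<in> carrier P"
      "p \<sqsubseteq>\<^bsub>P\<^esub> act m q"
      using Hom_grothendieckE[OF hk(1)] by blast
    obtain n where k: "k = (q, n, r)" "n \<in> carrier M" "r \<in> carrier P" "q \<sqsubseteq>\<^bsub>P\<^esub> act n r"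
      using Hom_grothendieckE[OF hk(2)] by blast
    have "act m q \<sqsubseteq>\<^bsub>P\<^esub> act m (act n r)"
      using h k by (intro act_mono act_closed)
    then have "p \<sqsubseteq>\<^bsub>P\<^esub> act (m \<otimes>\<^bsub>M\<^esub> n) r"
      using h k by (auto simp: act_mult intro: le_trans act_closed)
    then show ?thesis using h k by (simp add: Hom_grothendieck)
  qed
  show "h \<cdot>\<^bsub>?G\<^esub> Ident ?G p = h" "Ident ?G q \<cdot>\<^bsub>?G\<^esub> h = h" if "h \<in> Hom ?G p q" for p q h
    using that by (auto elim!: Hom_grothendieckE)
  show "(l \<cdot>\<^bsub>?G\<^esub> k) \<cdot>\<^bsub>?G\<^esub> h = l \<cdot>\<^bsub>?G\<^esub> (k \<cdot>\<^bsub>?G\<^esub> h)"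
    if "h \<in> Hom ?G p q" "k \<in> Hom ?G q r" "l \<in> Hom ?G r t" for p q r t h k l
    using that by (auto elim!: Hom_grothendieckE simp: m_assoc)
qed


section \<open>Categories graded by a monoid and fibred over a poset\<close>

text \<open>Here \<open>d f\<close> plays the role of \<open>\<alpha> (F f)\<close>. Degrees multiply in diagrammatic order, as
  \<open>\<alpha>\<close> takes values in the opposite monoid.\<close>

locale graded_category = category A + monoid M
  for A :: "('o, 'a) cat" and M :: "('m, 'z) monoid_scheme" +
  fixes d :: "'a \<Rightarrow> 'm"
  assumes deg_closed: "f \<in> Hom A x y \<Longrightarrow> d f \<in> carrier M"
    and deg_Ident: "x \<in> Obj A \<Longrightarrow> d (Ident A x) = \<one>\<^bsub>M\<^esub>"
    and deg_Comp: "\<lbrakk>f \<in> Hom A x y; g \<in> Hom A y w\<rbrakk> \<Longrightarrow> d (g \<cdot>\<^bsub>A\<^esub> f) = d f \<otimes>\<^bsub>M\<^esub> d g"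
    and deg_inj: "\<lbrakk>f \<in> Hom A x y; g \<in> Hom A x y; d f = d g\<rbrakk> \<Longrightarrow> f = g"
begin

definition arrow_of_degree :: "'m \<Rightarrow> 'o \<Rightarrow> 'o \<Rightarrow> bool"
  where "arrow_of_degree m x y \<longleftrightarrow> (\<exists>f \<in> Hom A x y. d f = m)"

text \<open>For \<open>d f = \<alpha> (F f)\<close> these are the arrows called maximal in the definition of the induced
  action.\<close>

definition universal_arrow :: "'o \<Rightarrow> 'm \<Rightarrow> 'a \<Rightarrow> bool"
  where "universal_arrow y m f \<longleftrightarrow> f \<in> Arr A \<and> Cod A f = y \<and> d f = m \<and>
    (\<forall>f' \<in> Arr A. Cod A f' = y \<and> d f' = m \<longrightarrow>
      (\<exists>g \<in> Hom A (Dom A f') (Dom A f). f' = f \<cdot>\<^bsub>A\<^esub> g \<and> d g = \<one>\<^bsub>M\<^esub>))"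

lemma arrow_of_degree_trans:
  "\<lbrakk>arrow_of_degree m x y; arrow_of_degree n y w\<rbrakk> \<Longrightarrow> arrow_of_degree (m \<otimes>\<^bsub>M\<^esub> n) x w"
  unfolding arrow_of_degree_def using Comp_closed deg_Comp by metis

lemma arrow_of_degree_closed:
  "arrow_of_degree m x y \<Longrightarrow> x \<in> Obj A \<and> m \<in> carrier M \<and> y \<in> Obj A"
  unfolding arrow_of_degree_def using deg_closed Dom_closed Cod_closed
  by (auto simp: Hom_def)

lemma universal_arrowD:
  assumes "universal_arrow y m f"
  shows "f \<in> Hom A (Dom A f) y" "d f = m" "Dom A f \<in> Obj A"
  using assms Dom_closed by (auto simp: universal_arrow_def Hom_def)

text \<open>The source of a universal arrow of degree \<open>m\<close> is, in the preorder given by arrows of degree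
  \<open>\<one>\<close>, a largest object with an arrow of degree \<open>m\<close> to the given target.\<close>

lemma universal_arrow_represents:
  assumes f: "universal_arrow y m f"
  shows "arrow_of_degree m x y \<longleftrightarrow> arrow_of_degree \<one>\<^bsub>M\<^esub> x (Dom A f)"
proof
  assume "arrow_of_degree m x y"
  then show "arrow_of_degree \<one>\<^bsub>M\<^esub> x (Dom A f)"
    using f unfolding arrow_of_degree_def universal_arrow_def Hom_def by blast
next
  assume x: "arrow_of_degree \<one>\<^bsub>M\<^esub> x (Dom A f)"
  have f': "arrow_of_degree m (Dom A f) y"
    using universal_arrowD[OF f] by (auto simp: arrow_of_degree_def)
  show "arrow_of_degree m x y"
    using arrow_of_degree_trans[OF x f'] arrow_of_degree_closed[OF f'] by simp
qed

end

text \<open>The map \<open>\<beta>\<close> need not be injective: \<open>A\<close>, preordered by arrows of degree \<open>\<one>\<close>, is only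
  equivalent to \<open>P\<close>, and \<open>\<beta>'\<close> chooses one object over each element.\<close>

locale fibred_graded_category = graded_category A M d + partial_order P
  for A :: "('o, 'a) cat" and M :: "('m, 'z) monoid_scheme" and d :: "'a \<Rightarrow> 'm"
    and P :: "('p, 'y) gorder_scheme" +
  fixes \<beta> :: "'o \<Rightarrow> 'p" and \<beta>' :: "'p \<Rightarrow> 'o"
  assumes beta_closed: "x \<in> Obj A \<Longrightarrow> \<beta> x \<in> carrier P"
    and section_closed: "p \<in> carrier P \<Longrightarrow> \<beta>' p \<in> Obj A"
    and beta_section: "p \<in> carrier P \<Longrightarrow> \<beta> (\<beta>' p) = p"
    and beta_le_iff: "\<lbrakk>x \<in> Obj A; y \<in> Obj A\<rbrakk>
      \<Longrightarrow> \<beta> x \<sqsubseteq>\<^bsub>P\<^esub> \<beta> y \<longleftrightarrow> arrow_of_degree \<one>\<^bsub>M\<^esub> x y"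
    and universal_arrow_exists: "\<lbrakk>y \<in> Obj A; m \<in> carrier M\<rbrakk> \<Longrightarrow> \<exists>f. universal_arrow y m f"
    and degree_factorization:
      "\<lbrakk>m \<in> carrier M; n \<in> carrier M; arrow_of_degree (m \<otimes>\<^bsub>M\<^esub> n) x y\<rbrakk>
        \<Longrightarrow> \<exists>w. arrow_of_degree m x w \<and> arrow_of_degree n w y"
begin

definition act :: "'m \<Rightarrow> 'p \<Rightarrow> 'p"
  where "act m p = (THE q. \<exists>f. universal_arrow (\<beta>' p) m f \<and> q = \<beta> (Dom A f))"

text \<open>Sources of two universal arrows of the same degree and target are below each other, so
  \<open>\<beta>\<close> identifies them by antisymmetry of \<open>P\<close>.\<close>

lemma act_eq:
  assumes f: "universal_arrow (\<beta>' p) m f"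
  shows "act m p = \<beta> (Dom A f)"
  unfolding act_def
proof (rule the_equality)
  show "\<exists>g. universal_arrow (\<beta>' p) m g \<and> \<beta> (Dom A f) = \<beta> (Dom A g)"
    using f by blast
  have below: "\<beta> (Dom A g) \<sqsubseteq>\<^bsub>P\<^esub> \<beta> (Dom A h)"
    if "universal_arrow (\<beta>' p) m g" "universal_arrow (\<beta>' p) m h" for g h
  proof -
    have "arrow_of_degree m (Dom A g) (\<beta>' p)"
      using universal_arrowD[OF that(1)] by (auto simp: arrow_of_degree_def)
    then show ?thesis
      using universal_arrow_represents[OF that(2)] universal_arrowD(3)[OF that(1)]
        universal_arrowD(3)[OF that(2)] by (simp add: beta_le_iff)
  qed
  show "q = \<beta> (Dom A f)" if "\<exists>g. universal_arrow (\<beta>' p) m g \<and> q = \<beta> (Dom A g)" for q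
    using that f below universal_arrowD(3) beta_closed le_antisym by metis
qed

lemma act_closed: "\<lbrakk>m \<in> carrier M; p \<in> carrier P\<rbrakk> \<Longrightarrow> act m p \<in> carrier P"
  using universal_arrow_exists[OF section_closed] act_eq universal_arrowD(3) beta_closed
  by metis

lemma arrow_of_degree_section_iff:
  assumes "x \<in> Obj A" "m \<in> carrier M" "q \<in> carrier P"
  shows "arrow_of_degree m x (\<beta>' q) \<longleftrightarrow> \<beta> x \<sqsubseteq>\<^bsub>P\<^esub> act m q"
proof -
  obtain f where f: "universal_arrow (\<beta>' q) m f"
    using universal_arrow_exists section_closed assms by blast
  show ?thesis
    using assms universal_arrowD(3)[OF f]
    by (simp add: universal_arrow_represents[OF f] act_eq[OF f] beta_le_iff)
qed

lemma arrow_of_degree_iff: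
  assumes "x \<in> Obj A" "m \<in> carrier M" "y \<in> Obj A"
  shows "arrow_of_degree m x y \<longleftrightarrow> \<beta> x \<sqsubseteq>\<^bsub>P\<^esub> act m (\<beta> y)"
proof -
  \<comment> \<open>Both \<open>y\<close> and \<open>\<beta>' (\<beta> y)\<close> lie over \<open>\<beta> y\<close>, hence are connected in both directions by arrows
    of degree \<open>\<one>\<close>.\<close>
  have "arrow_of_degree \<one>\<^bsub>M\<^esub> y (\<beta>' (\<beta> y))" "arrow_of_degree \<one>\<^bsub>M\<^esub> (\<beta>' (\<beta> y)) y"
    using assms by (simp_all add: beta_le_iff[symmetric] beta_closed section_closed beta_section)
  then have "arrow_of_degree m x y \<longleftrightarrow> arrow_of_degree m x (\<beta>' (\<beta> y))"
    using arrow_of_degree_trans r_one[OF assms(2)] by metis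
  then show ?thesis
    using assms by (simp add: arrow_of_degree_section_iff beta_closed)
qed

lemma le_act_iff:
  assumes "p \<in> carrier P" "m \<in> carrier M" "q \<in> carrier P"
  shows "p \<sqsubseteq>\<^bsub>P\<^esub> act m q \<longleftrightarrow> arrow_of_degree m (\<beta>' p) (\<beta>' q)"
  using assms by (simp add: arrow_of_degree_section_iff section_closed beta_section)

lemma eq_if_same_lower_set:
  assumes "q \<in> carrier P" "r \<in> carrier P"
    and "\<And>p. p \<in> carrier P \<Longrightarrow> p \<sqsubseteq>\<^bsub>P\<^esub> q \<longleftrightarrow> p \<sqsubseteq>\<^bsub>P\<^esub> r"
  shows "q = r"
  using assms le_antisym le_refl by metis

lemma act_mono:
  assumes "m \<in> carrier M" "p \<in> carrier P" "q \<in> carrier P" "p \<sqsubseteq>\<^bsub>P\<^esub> q"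
  shows "act m p \<sqsubseteq>\<^bsub>P\<^esub> act m q"
proof -
  have "arrow_of_degree m (\<beta>' (act m p)) (\<beta>' p)"
    using assms by (simp add: le_act_iff[symmetric] act_closed)
  moreover have "arrow_of_degree \<one>\<^bsub>M\<^esub> (\<beta>' p) (\<beta>' q)"
    using assms by (simp add: beta_le_iff[symmetric] section_closed beta_section)
  ultimately have "arrow_of_degree m (\<beta>' (act m p)) (\<beta>' q)"
    using arrow_of_degree_trans r_one[OF assms(1)] by metis
  then show ?thesis using assms by (simp add: le_act_iff act_closed)
qed

lemma act_one:
  assumes "p \<in> carrier P"
  shows "act \<one>\<^bsub>M\<^esub> p = p"
  using assms
  by (intro eq_if_same_lower_set)
    (simp_all add: act_closed le_act_iff beta_le_iff[symmetric] section_closed beta_section)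

text \<open>Below \<open>(m n) p\<close> are the \<open>q\<close> with an arrow \<open>\<beta>' q \<rightarrow> \<beta>' p\<close> of degree \<open>m n\<close>, below \<open>m (n p)\<close>
  those with arrows \<open>\<beta>' q \<rightarrow> w \<rightarrow> \<beta>' p\<close> of degrees \<open>m\<close> and \<open>n\<close>. The largest choice of \<open>w\<close> is
  \<open>\<beta>' (n p)\<close>.\<close>

lemma act_mult:
  assumes m: "m \<in> carrier M" and n: "n \<in> carrier M" and p: "p \<in> carrier P"
  shows "act (m \<otimes>\<^bsub>M\<^esub> n) p = act m (act n p)"
proof (rule eq_if_same_lower_set)
  fix q assume q: "q \<in> carrier P"
  show "q \<sqsubseteq>\<^bsub>P\<^esub> act (m \<otimes>\<^bsub>M\<^esub> n) p \<longleftrightarrow> q \<sqsubseteq>\<^bsub>P\<^esub> act m (act n p)"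
  proof
    assume "q \<sqsubseteq>\<^bsub>P\<^esub> act (m \<otimes>\<^bsub>M\<^esub> n) p"
    then have "arrow_of_degree (m \<otimes>\<^bsub>M\<^esub> n) (\<beta>' q) (\<beta>' p)"
      using m n p q by (simp add: le_act_iff)
    then obtain w where w: "arrow_of_degree m (\<beta>' q) w" "arrow_of_degree n w (\<beta>' p)"
      using degree_factorization m n by blast
    have w_Obj: "w \<in> Obj A" using arrow_of_degree_closed w(1) by blast
    have "q \<sqsubseteq>\<^bsub>P\<^esub> act m (\<beta> w)"
      using w(1) w_Obj m q by (simp add: arrow_of_degree_iff section_closed beta_section)
    moreover have "act m (\<beta> w) \<sqsubseteq>\<^bsub>P\<^esub> act m (act n p)"
      using w(2) w_Obj m n p
      by (intro act_mono) (simp_all add: arrow_of_degree_section_iff beta_closed act_closed)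
    ultimately show "q \<sqsubseteq>\<^bsub>P\<^esub> act m (act n p)"
      using q m n p w_Obj by (meson le_trans act_closed beta_closed)
  next
    assume "q \<sqsubseteq>\<^bsub>P\<^esub> act m (act n p)"
    then have "arrow_of_degree m (\<beta>' q) (\<beta>' (act n p))"
      using m n p q by (simp add: le_act_iff act_closed)
    moreover have "arrow_of_degree n (\<beta>' (act n p)) (\<beta>' p)"
      using n p by (simp add: le_act_iff[symmetric] act_closed)
    ultimately show "q \<sqsubseteq>\<^bsub>P\<^esub> act (m \<otimes>\<^bsub>M\<^esub> n) p"
      using m n p q arrow_of_degree_trans by (simp add: le_act_iff)
  qed
qed (use m n p in \<open>simp_all add: act_closed\<close>)

lemma monoid_poset_action_act: "monoid_poset_action M P act"
  by unfold_locales (simp_all add: act_closed act_one act_mult act_mono)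

lemma is_equivalence_grothendieck:
  "is_equivalence A (grothendieck P M act)
    \<lparr>omap = \<beta>, amap = (\<lambda>f. (\<beta> (Dom A f), d f, \<beta> (Cod A f)))\<rparr>"
  (is "is_equivalence A ?G ?E")
proof (rule fully_faithful_with_section_is_equivalence)
  have E_arrow: "amap ?E f = (\<beta> x, d f, \<beta> y)" if "f \<in> Hom A x y" for f x y
    using that by (simp add: Hom_def)
  have E_hom: "amap ?E f \<in> Hom ?G (omap ?E x) (omap ?E y)" if f: "f \<in> Hom A x y" for f x y
  proof -
    have xy: "x \<in> Obj A" "y \<in> Obj A" using Hom_Obj[OF category_axioms f] by auto
    have "arrow_of_degree (d f) x y" using f by (auto simp: arrow_of_degree_def)
    then show ?thesis
      using xy deg_closed[OF f] unfolding E_arrow[OF f]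
      by (simp add: Hom_grothendieck beta_closed arrow_of_degree_iff)
  qed
  show "is_functor A ?G ?E"
  proof (rule is_functorI[OF category_axioms])
    show "category ?G"
      by (rule monoid_poset_action.category_grothendieck[OF monoid_poset_action_act])
    show "omap ?E x \<in> Obj ?G" if "x \<in> Obj A" for x using that by (simp add: beta_closed)
    show "amap ?E f \<in> Hom ?G (omap ?E x) (omap ?E y)" if "f \<in> Hom A x y" for x y f
      by (rule E_hom[OF that])
    show "amap ?E (Ident A x) = Ident ?G (omap ?E x)" if "x \<in> Obj A" for x
      unfolding E_arrow[OF Ident_closed[OF that]] using that by (simp add: deg_Ident)
    show "amap ?E (g \<cdot>\<^bsub>A\<^esub> f) = amap ?E g \<cdot>\<^bsub>?G\<^esub> amap ?E f"
      if "f \<in> Hom A x y" "g \<in> Hom A y w" for x y w f g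
      unfolding E_arrow[OF that(1)] E_arrow[OF that(2)] E_arrow[OF Comp_closed[OF that]]
      using that by (simp add: deg_Comp)
  qed
  show "\<beta>' p \<in> Obj A" if "p \<in> Obj ?G" for p using that by (simp add: section_closed)
  show "omap ?E (\<beta>' p) = p" if "p \<in> Obj ?G" for p using that by (simp add: beta_section)
  show "bij_betw (amap ?E) (Hom A x y) (Hom ?G (omap ?E x) (omap ?E y))"
    if xy: "x \<in> Obj A" "y \<in> Obj A" for x y
    unfolding bij_betw_def
  proof
    show "inj_on (amap ?E) (Hom A x y)"
      by (rule inj_onI) (simp add: deg_inj)
    have "h \<in> amap ?E ` Hom A x y" if h: "h \<in> Hom ?G (omap ?E x) (omap ?E y)" for h
    proof -
      obtain m where m: "h = (\<beta> x, m, \<beta> y)" "m \<in> carrier M" "\<beta> x \<sqsubseteq>\<^bsub>P\<^esub> act m (\<beta> y)"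
        using h by (auto elim: Hom_grothendieckE)
      then obtain f where "f \<in> Hom A x y" "d f = m"
        using xy arrow_of_degree_iff[of x m y] unfolding arrow_of_degree_def by blast
      then show ?thesis using m(1) E_arrow by (intro image_eqI[of _ _ f]) auto
    qed
    then show "amap ?E ` Hom A x y = Hom ?G (omap ?E x) (omap ?E y)"
      using E_hom by blast
  qed
qed

end


section \<open>The equivalence with the Grothendieck construction\<close>

text \<open>It remains to read the hypotheses in terms of the degree \<open>\<alpha> (F f)\<close>. An arrow \<open>g\<close> has degree
  \<open>\<one>\<close> if and only if \<open>F g\<close> is the identity, as \<open>\<alpha>\<close> is injective.\<close>

theorem theorem5p4:
  fixes A :: "('o, 'a) cat"
    and P :: "('p, 'y) gorder_scheme"
    and M :: "('m, 'z) monoid_scheme"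
    and zero :: 'o
    and F :: "('o, 'a, 'o, 'a) ftor"
    and \<alpha> :: "'a \<Rightarrow> 'm"
    and \<beta> :: "'o \<Rightarrow> 'p"
    and \<beta>' :: "'p \<Rightarrow> 'o"
  assumes cat: "category A" and poset: "partial_order P" and mon: "monoid M"
    and A1: "weak_initial A zero \<and> (\<forall>z. weak_initial A z \<longrightarrow> isomorphic A zero z)"
    and A2: "is_functor A (endo_cat A zero) F \<and> faithful A F \<and>
      left_inverse_of_inclusion (endo_cat A zero) F"
    and A3: "\<alpha> \<in> iso (endo_monoid A zero) (op_monoid M)"
    and A4: "preorder_equivalence (arrow_preorder A zero F) P \<beta> \<beta>'"
    and A5: "\<forall>x \<in> Obj A. \<exists>f \<in> Hom A x (\<beta>' (\<beta> x)). is_isomorphism A f \<and> \<alpha> (amap F f) = \<one>\<^bsub>M\<^esub>"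
    and A6: "\<forall>y \<in> Obj A. \<forall>m \<in> Hom A zero zero.
      \<exists>x \<in> Obj A. \<exists>f \<in> Hom A x y. amap F f = m \<and>
        (\<forall>x' \<in> Obj A. \<forall>f' \<in> Hom A x' y. amap F f' = m \<longrightarrow>
          (\<exists>g \<in> Hom A x' x. f' = f \<cdot>\<^bsub>A\<^esub> g \<and> amap F g = Ident A zero))"
    and A7: "\<forall>f \<in> Arr A. \<forall>m\<^sub>1 \<in> carrier M. \<forall>m\<^sub>2 \<in> carrier M.
      \<alpha> (amap F f) = m\<^sub>2 \<otimes>\<^bsub>M\<^esub> m\<^sub>1 \<longrightarrow>
        (\<exists>f\<^sub>1 \<in> Arr A. \<exists>f\<^sub>2 \<in> Arr A. Dom A f\<^sub>1 = Cod A f\<^sub>2 \<and> f = f\<^sub>1 \<cdot>\<^bsub>A\<^esub> f\<^sub>2 \<and>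
          \<alpha> (amap F f\<^sub>1) = m\<^sub>1 \<and> \<alpha> (amap F f\<^sub>2) = m\<^sub>2)"
  shows "monoid_poset_action M P (induced_action A zero F \<alpha> \<beta> \<beta>') \<and>
    (\<forall>m \<in> carrier M. \<forall>p \<in> carrier P. \<forall>f. maximal_arrow A zero F \<alpha> (\<beta>' p) m f \<longrightarrow>
      induced_action A zero F \<alpha> \<beta> \<beta>' m p = \<beta> (Dom A f)) \<and>
    is_equivalence A (grothendieck P M (induced_action A zero F \<alpha> \<beta> \<beta>'))
      \<lparr>omap = \<beta>, amap = (\<lambda>f. (\<beta> (Dom A f), \<alpha> (amap F f), \<beta> (Cod A f)))\<rparr>"
proof -
  interpret A: category A by (rule cat)
  interpret M: monoid M by (rule mon)
  interpret P: partial_order P by (rule poset)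
  define d where "d f = \<alpha> (amap F f)" for f
  have F: "is_functor A (endo_cat A zero) F" and F_faithful: "faithful A F"
    using A2 by auto
  have zero: "zero \<in> Obj A" using A1 by (simp add: weak_initial_def)
  note id_zero = A.Ident_closed[OF zero]
  have F_omap: "omap F x = zero" if "x \<in> Obj A" for x
    using is_functorD(3)[OF F that] by (simp add: endo_cat_def)
  have F_hom: "amap F f \<in> Hom A zero zero" if "f \<in> Hom A x y" for f x y
    using is_functorD(4)[OF F that] by (simp add: endo_cat_def Hom_def)
  have F_id: "amap F (Ident A x) = Ident A zero" if "x \<in> Obj A" for x
    using is_functorD(5)[OF F that] F_omap[OF that] by (simp add: endo_cat_def)
  have F_comp: "amap F (g \<cdot>\<^bsub>A\<^esub> f) = amap F g \<cdot>\<^bsub>A\<^esub> amap F f"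
    if "f \<in> Hom A x y" "g \<in> Hom A y w" for f g x y w
    using is_functorD(6)[OF F that] by (simp add: endo_cat_def)
  have \<alpha>_closed: "\<alpha> a \<in> carrier M" if "a \<in> Hom A zero zero" for a
    using A3 that by (auto simp: iso_def hom_def endo_monoid_def op_monoid_def)
  have \<alpha>_comp: "\<alpha> (a \<cdot>\<^bsub>A\<^esub> b) = \<alpha> b \<otimes>\<^bsub>M\<^esub> \<alpha> a"
    if "a \<in> Hom A zero zero" "b \<in> Hom A zero zero" for a b
    using A3 that by (auto simp: iso_def hom_def endo_monoid_def op_monoid_def)
  have \<alpha>_bij: "bij_betw \<alpha> (Hom A zero zero) (carrier M)"
    using A3 by (auto simp: iso_def endo_monoid_def op_monoid_def)
  have \<alpha>_id: "\<alpha> (Ident A zero) = \<one>\<^bsub>M\<^esub>"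
  proof -
    \<comment> \<open>Elements of \<^const>\<open>iso\<close> are required to preserve products only. The unit is preserved
      by surjectivity: take \<open>u\<close> over \<open>\<one>\<close> and use that \<open>u\<close> followed by the identity
      is \<open>u\<close>.\<close>
    obtain u where u: "u \<in> Hom A zero zero" "\<alpha> u = \<one>\<^bsub>M\<^esub>"
      using \<alpha>_bij M.one_closed by (metis bij_betw_imp_surj_on imageE)
    then show ?thesis
      using \<alpha>_comp[OF id_zero u(1)] A.Comp_Ident_left[OF u(1)] \<alpha>_closed[OF id_zero]
      by simp
  qed
  have \<alpha>_inj: "a = b"
    if "\<alpha> a = \<alpha> b" "a \<in> Hom A zero zero" "b \<in> Hom A zero zero" for a b
    using \<alpha>_bij that by (auto simp: bij_betw_def dest: inj_onD)
  have d_one_iff: "d g = \<one>\<^bsub>M\<^esub> \<longleftrightarrow> amap F g = Ident A zero" if "g \<in> Hom A x y" for g x y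
    using \<alpha>_inj[OF _ F_hom[OF that] id_zero] \<alpha>_id by (auto simp: d_def)
  interpret G: graded_category A M d
  proof
    show "d f \<in> carrier M" if "f \<in> Hom A x y" for f x y
      using \<alpha>_closed[OF F_hom[OF that]] by (simp add: d_def)
    show "d (Ident A x) = \<one>\<^bsub>M\<^esub>" if "x \<in> Obj A" for x
      using that by (simp add: d_def F_id \<alpha>_id)
    show "d (g \<cdot>\<^bsub>A\<^esub> f) = d f \<otimes>\<^bsub>M\<^esub> d g" if "f \<in> Hom A x y" "g \<in> Hom A y w" for f g x y w
      using F_comp[OF that] \<alpha>_comp[OF F_hom[OF that(2)] F_hom[OF that(1)]]
      by (simp add: d_def)
    show "f = g" if fg: "f \<in> Hom A x y" "g \<in> Hom A x y" "d f = d g" for f g x y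
    proof -
      have "amap F f = amap F g"
        using \<alpha>_inj[OF _ F_hom[OF fg(1)] F_hom[OF fg(2)]] fg(3) by (simp add: d_def)
      then show ?thesis
        using F_faithful fg Hom_Obj[OF cat fg(1)] unfolding faithful_def
        by (auto dest: inj_onD)
    qed
  qed
  have arrow_le_iff: "arrow_le A zero F x y \<longleftrightarrow> G.arrow_of_degree \<one>\<^bsub>M\<^esub> x y" for x y
    unfolding arrow_le_def G.arrow_of_degree_def using d_one_iff by blast
  have maximal_iff: "maximal_arrow A zero F \<alpha> y m f \<longleftrightarrow> G.universal_arrow y m f" for y m f
    unfolding maximal_arrow_def G.universal_arrow_def
    using d_one_iff by (auto simp: d_def)
  have \<beta>_closed: "\<beta> x \<in> carrier P" if "x \<in> Obj A" for x
    using A4 that by (auto simp: preorder_equivalence_def arrow_preorder_def)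
  have \<beta>'_closed: "\<beta>' p \<in> Obj A" if "p \<in> carrier P" for p
    using A4 that by (auto simp: preorder_equivalence_def arrow_preorder_def)
  have \<beta>_mono: "\<beta> x \<sqsubseteq>\<^bsub>P\<^esub> \<beta> y"
    if "x \<in> Obj A" "y \<in> Obj A" "G.arrow_of_degree \<one>\<^bsub>M\<^esub> x y" for x y
    using A4 that
    by (auto simp: preorder_equivalence_def arrow_preorder_def isotone_def arrow_le_iff)
  have \<beta>'_mono: "G.arrow_of_degree \<one>\<^bsub>M\<^esub> (\<beta>' p) (\<beta>' q)"
    if "p \<in> carrier P" "q \<in> carrier P" "p \<sqsubseteq>\<^bsub>P\<^esub> q" for p q
    using A4 that
    by (auto simp: preorder_equivalence_def arrow_preorder_def isotone_def arrow_le_iff)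
  have \<beta>'_\<beta>: "G.arrow_of_degree \<one>\<^bsub>M\<^esub> (\<beta>' (\<beta> x)) x" "G.arrow_of_degree \<one>\<^bsub>M\<^esub> x (\<beta>' (\<beta> x))"
    if "x \<in> Obj A" for x
    using A4 that by (auto simp: preorder_equivalence_def arrow_preorder_def arrow_le_iff)
  have \<beta>_\<beta>': "\<beta> (\<beta>' p) = p" if "p \<in> carrier P" for p
    using A4 that P.eq_is_equal by (auto simp: preorder_equivalence_def)
  interpret G: fibred_graded_category A M d P \<beta> \<beta>'
  proof
    show "\<beta> x \<in> carrier P" if "x \<in> Obj A" for x by (rule \<beta>_closed[OF that])
    show "\<beta>' p \<in> Obj A" if "p \<in> carrier P" for p by (rule \<beta>'_closed[OF that])
    show "\<beta> (\<beta>' p) = p" if "p \<in> carrier P" for p by (rule \<beta>_\<beta>'[OF that])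
    show "\<beta> x \<sqsubseteq>\<^bsub>P\<^esub> \<beta> y \<longleftrightarrow> G.arrow_of_degree \<one>\<^bsub>M\<^esub> x y" if "x \<in> Obj A" "y \<in> Obj A" for x y
    proof
      assume "\<beta> x \<sqsubseteq>\<^bsub>P\<^esub> \<beta> y"
      then have "G.arrow_of_degree \<one>\<^bsub>M\<^esub> (\<beta>' (\<beta> x)) (\<beta>' (\<beta> y))"
        using that by (intro \<beta>'_mono \<beta>_closed)
      then show "G.arrow_of_degree \<one>\<^bsub>M\<^esub> x y"
        using \<beta>'_\<beta>(2)[OF that(1)] \<beta>'_\<beta>(1)[OF that(2)] G.arrow_of_degree_trans
          M.l_one[OF M.one_closed] by metis
    qed (rule \<beta>_mono[OF that])
    show "\<exists>f. G.universal_arrow y m f" if y: "y \<in> Obj A" and m: "m \<in> carrier M" for y m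
    proof -
      obtain a where a: "a \<in> Hom A zero zero" "\<alpha> a = m"
        using \<alpha>_bij m by (metis bij_betw_imp_surj_on imageE)
      obtain x f where x: "x \<in> Obj A" and f: "f \<in> Hom A x y" "amap F f = a"
        and univ: "\<forall>x' \<in> Obj A. \<forall>f' \<in> Hom A x' y. amap F f' = a \<longrightarrow>
          (\<exists>g \<in> Hom A x' x. f' = f \<cdot>\<^bsub>A\<^esub> g \<and> amap F g = Ident A zero)"
        using A6[THEN bspec, OF y, THEN bspec, OF a(1)] by (elim bexE conjE)
      have "\<exists>g \<in> Hom A (Dom A f') (Dom A f). f' = f \<cdot>\<^bsub>A\<^esub> g \<and> amap F g = Ident A zero"
        if f': "f' \<in> Arr A" "Cod A f' = y" "\<alpha> (amap F f') = m" for f'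
      proof -
        have hom: "f' \<in> Hom A (Dom A f') y" using f' by (simp add: Hom_def)
        have "amap F f' = a"
          by (rule \<alpha>_inj) (use a f' F_hom[OF hom] in simp_all)
        then show ?thesis
          using univ A.Dom_closed[OF f'(1)] hom f(1) by (simp add: Hom_def)
      qed
      then have "maximal_arrow A zero F \<alpha> y m f"
        using f a(2) by (simp add: maximal_arrow_def Hom_def)
      then show ?thesis using maximal_iff by blast
    qed
    show "\<exists>w. G.arrow_of_degree m x w \<and> G.arrow_of_degree n w y"
      if m: "m \<in> carrier M" and n: "n \<in> carrier M"
        and xy: "G.arrow_of_degree (m \<otimes>\<^bsub>M\<^esub> n) x y" for m n x y
    proof -
      obtain f where f: "f \<in> Hom A x y" "\<alpha> (amap F f) = m \<otimes>\<^bsub>M\<^esub> n"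
        using xy by (auto simp: G.arrow_of_degree_def d_def)
      have "f \<in> Arr A" using f(1) by (simp add: Hom_def)
      then obtain f\<^sub>1 f\<^sub>2 where f12: "f\<^sub>1 \<in> Arr A" "f\<^sub>2 \<in> Arr A" "Dom A f\<^sub>1 = Cod A f\<^sub>2"
        "f = f\<^sub>1 \<cdot>\<^bsub>A\<^esub> f\<^sub>2" "d f\<^sub>1 = n" "d f\<^sub>2 = m"
        using A7 f(2) m n unfolding d_def by meson
      have "f \<in> Hom A (Dom A f\<^sub>2) (Cod A f\<^sub>1)"
        unfolding f12(4) using f12 by (intro A.Comp_closed) (auto simp: Hom_def)
      then have "f\<^sub>2 \<in> Hom A x (Cod A f\<^sub>2)" "f\<^sub>1 \<in> Hom A (Cod A f\<^sub>2) y"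
        using f(1) f12 by (auto simp: Hom_def)
      then show ?thesis using f12 by (auto simp: G.arrow_of_degree_def)
    qed
  qed
  have act_eq: "induced_action A zero F \<alpha> \<beta> \<beta>' = G.act"
    by (intro ext) (simp add: induced_action_def G.act_def maximal_iff)
  show ?thesis
    using G.monoid_poset_action_act G.act_eq G.is_equivalence_grothendieck
    by (simp add: act_eq maximal_iff d_def)
qed

end
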